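(* Let $\Omega_1,\Omega_2\subset\mathbb{R}^n$ be compact, let $\lambda_i$ be a finite non-negative Radon measure on $\Omega_i$ with $\operatorname{spt}\lambda_i=\Omega_i$ ($i=1,2$), and put $\Omega=\Omega_1\times\Omega_2$, $\lambda=\lambda_1\otimes\lambda_2$. Let $p\ge2$, $\tfrac1p+\tfrac1q=1$, $\gamma>0$. Let $c:\Omega\to\mathbb{R}$ be continuous with $c\ge c^\dagger$ for some constant $c^\dagger>-\infty$. For $i=1,2$ let $\mu_i$ be a probability measure on $\Omega_i$ with $\mu_i\ll\lambda_i$, $\tfrac{\mathrm{d}\mu_i}{\mathrm{d}\lambda_i}\in L^p(\Omega_i,\mathrm{d}\lambda_i)$ and $\tfrac{\mathrm{d}\mu_i}{\mathrm{d}\lambda_i}\ge\delta>0$ $\lambda_i$-a.e. for a constant $\delta$. Consider the problem $$(\mathrm{P}^\dagger)\qquad \min\Big\{\tfrac1q\big\|(\alpha_1\oplus\alpha_2-c)_+\big\|_{L^q(\Omega,\mathrm{d}\lambda)}^q-\gamma^{q-1}\int_{\Omega_1}\alpha_1\,\mathrm{d}\mu_1-\gamma^{q-1}\int_{\Omega_2}\alpha_2\,\mathrm{d}\mu_2\ \Big|\ \alpha_i\in L^1(\Omega_i,\mathrm{d}\lambda_i),\ i=1,2,\ \tfrac1\gamma(\alpha_1\oplus\alpha_2-c)_+\in L^q(\Omega,\mathrm{d}\lambda)\Big\}.$$ Then every optimal solution $(\bar\alpha_1,\bar\alpha_2)\in L^1(\Omega_1,\mathrm{d}\lambda_1)\times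 L^1(\Omega_2,\mathrm{d}\lambda_2)$ of $(\mathrm{P}^\dagger)$ satisfies $\bar\alpha_i\in L^q(\Omega_i,\mathrm{d}\lambda_i)$ for $i=1,2$. Moreover, the negative parts of $\bar\alpha_1,\bar\alpha_2$ are (essentially) bounded, and the function $\tfrac1{\gamma^{q-1}}(\bar\alpha_1\oplus\bar\alpha_2-c)_+^{q-1}$ has the marginals $\tfrac{\mathrm{d}\mu_1}{\mathrm{d}\lambda_1}$ and $\tfrac{\mathrm{d}\mu_2}{\mathrm{d}\lambda_2}$, i.e. $$\int_{\Omega_2}\tfrac{1}{\gamma^{q-1}}(\bar\alpha_1\oplus\bar\alpha_2-c)_+^{q-1}\,\mathrm{d}\lambda_2=\tfrac{\mathrm{d}\mu_1}{\mathrm{d}\lambda_1}\ \ \lambda_1\text{-a.e.},\qquad \int_{\Omega_1}\tfrac{1}{\gamma^{q-1}}(\bar\alpha_1\oplus\bar\alpha_2-c)_+^{q-1}\,\mathrm{d}\lambda_1=\tfrac{\mathrm{d}\mu_2}{\mathrm{d}\lambda_2}\ \ \lambda_2\text{-a.e.}$$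
   Context: $(\alpha_1\oplus\alpha_2)(x_1,x_2)=\alpha_1(x_1)+\alpha_2(x_2)$. For real-valued $f$, $f_+=\max(f,0)$ and $f_-=-\min(f,0)$; $f_+^r$ means $(f_+)^r$. On the feasible set of $(\mathrm{P}^\dagger)$ the positive parts of $\alpha_i$ lie in $L^q(\Omega_i,\mathrm{d}\lambda_i)$, so the integrals $\int\alpha_i\,\mathrm{d}\mu_i$ are well defined in $[-\infty,\infty)$ and the objective takes values in $(-\infty,\infty]$. *)

theory Defs
  imports "HOL-Probability.Probability"
begin

definition fsum :: "('a \<Rightarrow> real) \<Rightarrow> ('b \<Rightarrow> real) \<Rightarrow> 'a \<times> 'b \<Rightarrow> real"  (infixl "\<oplus>\<^sub>f" 65)
  where "a1 \<oplus>\<^sub>f a2 = (\<lambda>(x1, x2). a1 x1 + a2 x2)"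

definition pos_part :: "('a \<Rightarrow> real) \<Rightarrow> 'a \<Rightarrow> real"
  where "pos_part f = (\<lambda>x. max (f x) 0)"

definition neg_part :: "('a \<Rightarrow> real) \<Rightarrow> 'a \<Rightarrow> real"
  where "neg_part f = (\<lambda>x. - min (f x) 0)"

text \<open>The elements of \<open>L\<^sup>r\<close> are represented by measurable functions rather than by classes
  modulo null sets; only \<open>1 \<le> r < \<infinity>\<close> is of interest.\<close>

definition Lspace :: "real \<Rightarrow> 'a measure \<Rightarrow> ('a \<Rightarrow> real) set"
  where "Lspace r M = {f \<in> borel_measurable M. integrable M (\<lambda>x. \<bar>f x\<bar> powr r)}"

definition Lnorm :: "real \<Rightarrow> 'a measure \<Rightarrow> ('a \<Rightarrow> real) \<Rightarrow> real"
  where "Lnorm r M f = (LINT x|M. \<bar>f x\<bar> powr r) powr (1 / r)"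

definition finite_radon_measure_on :: "'a::topological_space set \<Rightarrow> 'a measure \<Rightarrow> bool"
  where "finite_radon_measure_on \<Omega> M \<longleftrightarrow>
    sets M = sets (restrict_space borel \<Omega>) \<and> finite_measure M \<and>
    (\<forall>B\<in>sets M. emeasure M B = (SUP K\<in>{K. K \<subseteq> B \<and> compact K \<and> K \<in> sets M}. emeasure M K))"

definition spt :: "'a::topological_space measure \<Rightarrow> 'a set"
  where "spt M = {x \<in> space M. \<forall>U. open U \<and> x \<in> U \<longrightarrow> emeasure M (U \<inter> space M) > 0}"

text \<open>The library's \<^const>\<open>RN_deriv\<close> takes values in \<^typ>\<open>ennreal\<close>; for a finite measure \<open>N\<close> it is
  finite almost everywhere, so passing to real values only changes it on a null set.\<close>

definition real_RN_deriv :: "'a measure \<Rightarrow> 'a measure \<Rightarrow> 'a \<Rightarrow> real"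
  where "real_RN_deriv M N = (\<lambda>x. enn2real (RN_deriv M N x))"

text \<open>The integral as an extended real number. It is meaningful whenever one of the two parts is
  finite; on the feasible set below this is always the positive part, so that the value lies
  in \<open>[-\<infinity>, \<infinity>)\<close>. (The Bochner integral would give 0 instead of \<open>-\<infinity>\<close>.)\<close>

definition ereal_integral :: "'a measure \<Rightarrow> ('a \<Rightarrow> real) \<Rightarrow> ereal"
  where "ereal_integral M f =
    enn2ereal (\<integral>\<^sup>+ x. ennreal (pos_part f x) \<partial>M) - enn2ereal (\<integral>\<^sup>+ x. ennreal (neg_part f x) \<partial>M)"

definition P_feasible ::
  "real \<Rightarrow> real \<Rightarrow> 'a measure \<Rightarrow> 'b measure \<Rightarrow> ('a \<times> 'b \<Rightarrow> real) \<Rightarrow>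
    ('a \<Rightarrow> real) \<times> ('b \<Rightarrow> real) \<Rightarrow> bool"
  where "P_feasible q \<gamma> lam1 lam2 c = (\<lambda>(a1, a2).
    a1 \<in> Lspace 1 lam1 \<and> a2 \<in> Lspace 1 lam2 \<and>
    (\<lambda>z. 1 / \<gamma> * pos_part (\<lambda>z. (a1 \<oplus>\<^sub>f a2) z - c z) z) \<in> Lspace q (lam1 \<Otimes>\<^sub>M lam2))"

definition P_objective ::
  "real \<Rightarrow> real \<Rightarrow> 'a measure \<Rightarrow> 'b measure \<Rightarrow> ('a \<times> 'b \<Rightarrow> real) \<Rightarrow> 'a measure \<Rightarrow> 'b measure \<Rightarrow>
    ('a \<Rightarrow> real) \<times> ('b \<Rightarrow> real) \<Rightarrow> ereal"
  where "P_objective q \<gamma> lam1 lam2 c \<mu>1 \<mu>2 = (\<lambda>(a1, a2).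
    ereal (1 / q * Lnorm q (lam1 \<Otimes>\<^sub>M lam2) (pos_part (\<lambda>z. (a1 \<oplus>\<^sub>f a2) z - c z)) powr q)
    - ereal (\<gamma> powr (q - 1)) * ereal_integral \<mu>1 a1
    - ereal (\<gamma> powr (q - 1)) * ereal_integral \<mu>2 a2)"

definition P_optimal ::
  "real \<Rightarrow> real \<Rightarrow> 'a measure \<Rightarrow> 'b measure \<Rightarrow> ('a \<times> 'b \<Rightarrow> real) \<Rightarrow> 'a measure \<Rightarrow> 'b measure \<Rightarrow>
    ('a \<Rightarrow> real) \<times> ('b \<Rightarrow> real) \<Rightarrow> bool"
  where "P_optimal q \<gamma> lam1 lam2 c \<mu>1 \<mu>2 =
    is_arg_min (P_objective q \<gamma> lam1 lam2 c \<mu>1 \<mu>2) (P_feasible q \<gamma> lam1 lam2 c)"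

end

theory Submission
  imports Defs
begin

text \<open>Write \<open>u = \<alpha>\<^sub>1 \<oplus> \<alpha>\<^sub>2 - c\<close> for an optimal pair. The integrand \<open>u\<^sub>+ powr q\<close> is convex and
  differentiable in \<open>u\<close> with derivative \<open>q * u\<^sub>+ powr (q - 1)\<close>, so the marginal equations are the
  first-order optimality conditions of the problem.

  They are obtained without differentiating under the integral. As \<open>p \<ge> 2\<close>, the conjugate exponent
  satisfies \<open>1 < q \<le> 2\<close>, so the derivative is \<open>(q - 1)\<close>-Hoelder continuous and
  \<open>(s + h)\<^sub>+ powr q\<close> exceeds its linearisation by at most \<open>q * \<bar>h\<bar> powr q\<close>
  (\<open>pos_powr_add_le_expansion\<close>). For a bounded perturbation \<open>t * \<psi>\<close> this shows both that the perturbed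
  pair is feasible and that the objective grows by at most a linear term in \<open>t\<close> plus a multiple of
  \<open>\<bar>t\<bar> powr q\<close>. Optimality forces the linear term to vanish (\<open>stationarity\<close>), and indicator functions as
  perturbations give the two marginal equations (\<open>marginal_equations\<close>). Comparing values requires that
  the optimal value is finite and \<open>\<alpha>\<^sub>i\<close> is \<open>\<mu>\<^sub>i\<close>-integrable; this follows from a constant competitor and
  Hoelder's inequality.

  The positive parts are in \<open>L\<^sup>q\<close> for every feasible pair: on a suitable section of \<open>u\<^sub>+ powr q\<close> all terms
  but one are bounded (\<open>feasible_pos_parts\<close>). The negative parts are bounded by the marginal equation:
  its right-hand side, multiplied by \<open>\<gamma> powr (q - 1)\<close>, is at least \<open>\<gamma> powr (q - 1) * \<delta>\<close>, whereas
  \<open>\<integral> u\<^sub>+ powr (q - 1)\<close> over the section at \<open>x\<close> is arbitrarily small when \<open>\<alpha>\<^sub>1 x\<close> is very negative, because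
  then only the region where \<open>\<alpha>\<^sub>2\<close> is large contributes (\<open>neg_parts_bounded\<close>). On finite measure spaces
  the two facts together give \<open>\<alpha>\<^sub>i \<in> L\<^sup>q\<close>.\<close>

section \<open>Scalar inequalities\<close>

lemma powr_add_le_add_powr:
  fixes x y r :: real
  assumes "0 \<le> x" "0 \<le> y" "0 \<le> r" "r \<le> 1"
  shows "(x + y) powr r \<le> x powr r + y powr r"
proof (cases "x + y = 0")
  case False
  define s where "s = x + y"
  have s: "s > 0" using assms False by (simp add: s_def)
  have frac: "t / s \<le> (t / s) powr r" if "0 \<le> t" "t \<le> s" for t
    using powr_mono'[of r 1 "t / s"] that s assms by simp
  have "1 = x / s + y / s" using s by (simp add: s_def flip: add_divide_distrib)
  also have "\<dots> \<le> (x / s) powr r + (y / s) powr r"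
    using assms by (intro add_mono frac) (auto simp: s_def)
  also have "\<dots> = (x powr r + y powr r) / s powr r"
    using assms s by (simp add: powr_divide add_divide_distrib)
  finally show ?thesis using s by (simp add: s_def pos_le_divide_eq)
qed (use assms in auto)

text \<open>Convexity of \<open>max x 0 powr q\<close>: its graph lies above its tangent at \<open>y\<close>. For \<open>y > 0\<close>
  this is Young's inequality for the product of \<open>max x 0\<close> and \<open>y powr (q - 1)\<close>.\<close>
lemma tangent_le_pos_powr:
  fixes x y q :: real
  assumes q: "1 < q"
  shows "max y 0 powr q + q * max y 0 powr (q - 1) * (x - y) \<le> max x 0 powr q"
proof (cases "y \<le> 0")
  case True
  then show ?thesis by simp
next
  case False
  then have y: "y > 0" by simp
  have conj: "1 / q + 1 / (q / (q - 1)) = 1" "q / (q - 1) > 1"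
    using q by (auto simp: field_simps)
  have "max x 0 * y powr (q - 1) \<le> max x 0 powr q / q + (y powr (q - 1)) powr (q / (q - 1)) / (q / (q - 1))"
    using q conj y by (intro Youngs_inequality) auto
  also have "(y powr (q - 1)) powr (q / (q - 1)) = y powr q"
    using q by (simp add: powr_powr)
  finally have "q * (max x 0 * y powr (q - 1)) \<le> max x 0 powr q + (q - 1) * y powr q"
    using q by (simp add: field_simps)
  moreover have "q * (x * y powr (q - 1)) \<le> q * (max x 0 * y powr (q - 1))"
    using q by (intro mult_left_mono mult_right_mono) auto
  moreover have "y * y powr (q - 1) = y powr q"
    using y by (simp add: powr_diff)
  ultimately show ?thesis using y by (simp add: algebra_simps)
qed

text \<open>For \<open>r \<le> 1\<close> the function \<open>max x 0 powr r\<close> is Hoelder continuous with exponent \<open>r\<close> and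
  constant 1; multiplying by the increment \<open>h\<close> gives a one-sided estimate for both signs of \<open>h\<close>.\<close>
lemma pos_powr_increment_le:
  fixes s h r :: real
  assumes r: "0 \<le> r" "r \<le> 1"
  shows "max (s + h) 0 powr r * h \<le> max s 0 powr r * h + \<bar>h\<bar> powr (r + 1)"
proof -
  have h: "\<bar>h\<bar> powr (r + 1) = \<bar>h\<bar> powr r * \<bar>h\<bar>"
    by (cases "h = 0") (simp_all add: powr_add)
  have holder: "max v 0 powr r \<le> max w 0 powr r + \<bar>h\<bar> powr r" if "v \<le> w + \<bar>h\<bar>" for v w
  proof -
    have "max v 0 powr r \<le> (max w 0 + \<bar>h\<bar>) powr r"
      using r that by (intro powr_mono2) auto
    also have "\<dots> \<le> max w 0 powr r + \<bar>h\<bar> powr r"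
      using r by (intro powr_add_le_add_powr) auto
    finally show ?thesis .
  qed
  show ?thesis
  proof (cases "h \<ge> 0")
    case True
    then show ?thesis
      using mult_right_mono[OF holder[of "s + h" s], of h] h by (simp add: algebra_simps)
  next
    case False
    then show ?thesis
      using mult_right_mono_neg[OF holder[of s "s + h"], of h] h by (simp add: algebra_simps)
  qed
qed

text \<open>The upper counterpart of the tangent inequality. The tangent at \<open>s + h\<close> bounds the increment by
  \<open>h\<close> times the derivative at \<open>s + h\<close>; this derivative differs from the one at \<open>s\<close> by at most
  \<open>q * \<bar>h\<bar> powr (q - 1)\<close>, which is where \<open>q \<le> 2\<close> enters. The error is uniform in \<open>s\<close>, so the
  expansion can be integrated as it stands and no limit has to be exchanged with an integral.\<close>
lemma pos_powr_add_le_expansion: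
  fixes s h q :: real
  assumes q: "1 < q" "q \<le> 2"
  shows "max (s + h) 0 powr q \<le> max s 0 powr q + q * (max s 0 powr (q - 1) * h) + q * \<bar>h\<bar> powr q"
proof -
  have "max (s + h) 0 powr q + q * max (s + h) 0 powr (q - 1) * (- h) \<le> max s 0 powr q"
    using tangent_le_pos_powr[of q "s + h" s] q by simp
  moreover have "q * (max (s + h) 0 powr (q - 1) * h) \<le> q * (max s 0 powr (q - 1) * h + \<bar>h\<bar> powr q)"
    using pos_powr_increment_le[of "q - 1" s h] q by (intro mult_left_mono) auto
  ultimately show ?thesis by (simp add: algebra_simps)
qed

lemma powr_minus_one_le:
  fixes x q :: real
  assumes "1 < q"
  shows "max x 0 powr (q - 1) \<le> 1 + max x 0 powr q"
proof (cases "x \<le> 1")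
  case True
  then have "max x 0 powr (q - 1) \<le> 1" using assms by (intro powr_le1) auto
  then show ?thesis by (smt (verit) powr_ge_zero)
next
  case False
  then have "max x 0 powr (q - 1) \<le> max x 0 powr q" by (intro powr_mono) auto
  then show ?thesis by simp
qed

text \<open>The first-order condition at a minimum at \<open>t = 0\<close>, when the remainder is \<open>O(\<bar>t\<bar> powr q)\<close> with
  \<open>q > 1\<close>: after division by \<open>\<bar>t\<bar>\<close> the remainder tends to 0.\<close>
lemma linear_coefficient_eq_zero:
  fixes L K q :: real
  assumes q: "1 < q" and nonneg: "\<And>t. 0 \<le> L * t + K * \<bar>t\<bar> powr q"
  shows "L = 0"
proof -
  have le: "\<bar>L\<bar> \<le> K * t powr (q - 1)" if t: "t > 0" for t
  proof -
    have "t powr q = t powr (q - 1) * t" using t by (simp add: powr_diff)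
    then have "0 \<le> t * (K * t powr (q - 1) + L)" "0 \<le> t * (K * t powr (q - 1) - L)"
      using nonneg[of t] nonneg[of "- t"] t by (simp_all add: algebra_simps)
    then show ?thesis using t by (simp add: zero_le_mult_iff)
  qed
  have "((\<lambda>t::real. t powr (q - 1)) \<longlongrightarrow> 0) (at_right 0)"
    by (rule tendsto_eq_rhs[OF tendsto_powr'[of "\<lambda>t. t" 0 _ "\<lambda>_. q - 1" "q - 1"]])
       (use q in \<open>auto simp: eventually_at_filter intro!: tendsto_ident_at\<close>)
  from tendsto_mult_left[OF this, of K] have "((\<lambda>t. K * t powr (q - 1)) \<longlongrightarrow> 0) (at_right 0)"
    by simp
  then have "\<bar>L\<bar> \<le> 0"
    by (rule tendsto_lowerbound) (auto intro!: le eventually_at_right_less[THEN eventually_mono])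
  then show ?thesis by simp
qed

section \<open>Integrability of powers of positive parts\<close>

lemma integrable_pos_powr_minus_one:
  fixes s :: "'a \<Rightarrow> real"
  assumes "finite_measure M" "1 < q" and [measurable]: "s \<in> borel_measurable M"
    and "integrable M (\<lambda>x. max (s x) 0 powr q)"
  shows "integrable M (\<lambda>x. max (s x) 0 powr (q - 1))"
proof -
  interpret finite_measure M by fact
  show ?thesis
    by (rule Bochner_Integration.integrable_bound[of M "\<lambda>x. 1 + max (s x) 0 powr q"])
       (use assms powr_minus_one_le[OF \<open>1 < q\<close>] in auto)
qed

text \<open>On a finite measure space, integrability of \<open>s\<^sub>+ powr q\<close> survives bounded changes of \<open>s\<close>, as
  \<open>pos_powr_add_le_expansion\<close> dominates the changed function. This makes every bounded
  perturbation of a feasible pair feasible, and it also strips the bounded terms off a section of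
  \<open>(\<alpha>\<^sub>1 \<oplus> \<alpha>\<^sub>2 - c)\<^sub>+\<close>.\<close>
lemma integrable_pos_powr_bounded_shift:
  fixes s h :: "'a \<Rightarrow> real"
  assumes "finite_measure M" and q: "1 < q" "q \<le> 2"
    and s[measurable]: "s \<in> borel_measurable M" and h[measurable]: "h \<in> borel_measurable M"
    and bound: "\<And>x. x \<in> space M \<Longrightarrow> \<bar>h x\<bar> \<le> B"
    and int: "integrable M (\<lambda>x. max (s x) 0 powr q)"
  shows "integrable M (\<lambda>x. max (s x) 0 powr (q - 1) * h x)"
    and "integrable M (\<lambda>x. \<bar>h x\<bar> powr q)"
    and "integrable M (\<lambda>x. max (s x + h x) 0 powr q)"
proof -
  interpret finite_measure M by fact
  note int' = integrable_pos_powr_minus_one[OF \<open>finite_measure M\<close> q(1) s int]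
  show i1: "integrable M (\<lambda>x. max (s x) 0 powr (q - 1) * h x)"
  proof (rule Bochner_Integration.integrable_bound[of M "\<lambda>x. max (s x) 0 powr (q - 1) * B"])
    show "AE x in M. norm (max (s x) 0 powr (q - 1) * h x) \<le> norm (max (s x) 0 powr (q - 1) * B)"
    proof (rule AE_I2)
      fix x assume "x \<in> space M"
      with bound have "\<bar>h x\<bar> \<le> \<bar>B\<bar>" by force
      then show "norm (max (s x) 0 powr (q - 1) * h x) \<le> norm (max (s x) 0 powr (q - 1) * B)"
        by (simp add: abs_mult mult_left_mono)
    qed
  qed (use int' in auto)
  show i2: "integrable M (\<lambda>x. \<bar>h x\<bar> powr q)"
  proof (rule integrable_const_bound[of _ "\<bar>B\<bar> powr q"])
    show "AE x in M. norm (\<bar>h x\<bar> powr q) \<le> \<bar>B\<bar> powr q"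
    proof (rule AE_I2)
      fix x assume "x \<in> space M"
      with bound have "\<bar>h x\<bar> \<le> \<bar>B\<bar>" by force
      then show "norm (\<bar>h x\<bar> powr q) \<le> \<bar>B\<bar> powr q"
        using q by (simp add: powr_mono2)
    qed
  qed simp
  show "integrable M (\<lambda>x. max (s x + h x) 0 powr q)"
  proof (rule Bochner_Integration.integrable_bound)
    show "integrable M (\<lambda>x. max (s x) 0 powr q + q * (max (s x) 0 powr (q - 1) * h x) + q * \<bar>h x\<bar> powr q)"
      using int i1 i2 by auto
    show "AE x in M. norm (max (s x + h x) 0 powr q)
      \<le> norm (max (s x) 0 powr q + q * (max (s x) 0 powr (q - 1) * h x) + q * \<bar>h x\<bar> powr q)"
      using pos_powr_add_le_expansion[OF q] by (intro AE_I2) (force intro: order_trans[OF _ abs_ge_self])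
  qed simp
qed

text \<open>Quantitative core of the bound on the negative parts. If \<open>t + C < - N\<close>, then \<open>s y > 0\<close> forces
  \<open>b y > N\<close>, where \<open>b powr (q - 1) = b powr q / b \<le> b powr q / N\<close>. Hence the mass
  \<open>\<integral> s\<^sub>+ powr (q - 1)\<close> is at most \<open>(\<integral> b\<^sub>+ powr q) / N\<close>, which is below \<open>d\<close> once \<open>N\<close> is large.\<close>
lemma lower_bound_from_truncated_mass:
  fixes b s :: "'a \<Rightarrow> real"
  assumes q: "1 < q" and b: "integrable M (\<lambda>y. max (b y) 0 powr q)" and d: "d > 0"
    and s: "\<And>y. y \<in> space M \<Longrightarrow> s y \<le> t + b y + C"
    and mass: "d \<le> (LINT y|M. max (s y) 0 powr (q - 1))"
  shows "- t \<le> C + ((LINT y|M. max (b y) 0 powr q) + 1) / d"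
proof (rule ccontr)
  define K where "K = (LINT y|M. max (b y) 0 powr q)"
  \<comment> \<open>The summand 1 makes \<open>K / N < d\<close> strict and \<open>N\<close> positive even when \<open>K = 0\<close>.\<close>
  define N where "N = (K + 1) / d"
  have K: "K \<ge> 0" unfolding K_def by simp
  then have N: "N > 0" using d by (simp add: N_def)
  assume "\<not> ?thesis"
  then have t: "t + C < - N" by (simp add: K_def N_def)
  have le: "max (s y) 0 powr (q - 1) \<le> max (b y) 0 powr q / N" if y: "y \<in> space M" for y
  proof (cases "s y \<le> 0")
    case True
    then show ?thesis using N by simp
  next
    case False
    with s[OF y] t have by_gt: "b y > N" "s y \<le> b y" using N by auto
    then have "max (s y) 0 powr (q - 1) \<le> b y powr (q - 1)"
      using q False by (intro powr_mono2) auto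
    also have "\<dots> = b y powr q / b y"
      using by_gt N by (simp add: powr_diff)
    also have "\<dots> \<le> b y powr q / N"
      using by_gt N by (intro divide_left_mono) auto
    finally show ?thesis using by_gt N by simp
  qed
  have "d \<le> (LINT y|M. max (s y) 0 powr (q - 1))" by (fact mass)
  also have "\<dots> \<le> (LINT y|M. max (b y) 0 powr q / N)"
    using b le N by (intro integral_mono') auto
  also have "\<dots> = K / N" by (simp add: K_def)
  also have "\<dots> < d"
    using K d by (simp add: N_def field_simps)
  finally show False by simp
qed

section \<open>Extended real integrals\<close>

lemma ereal_integral_eq_integral:
  assumes "integrable M f"
  shows "ereal_integral M f = ereal (LINT x|M. f x)"
proof -
  have parts: "ennreal (pos_part f x) = ennreal (f x)" "ennreal (neg_part f x) = ennreal (- f x)" for x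
    by (auto simp: pos_part_def neg_part_def max_def min_def ennreal_neg)
  obtain a b where "0 \<le> a" "0 \<le> b" "(\<integral>\<^sup>+x. ennreal (f x)\<partial>M) = ennreal a"
    "(\<integral>\<^sup>+x. ennreal (- f x)\<partial>M) = ennreal b" "integral\<^sup>L M f = a - b"
    using integrableE[OF assms] by metis
  then show ?thesis by (simp add: ereal_integral_def parts)
qed

lemma ereal_integral_of_integrable_pos_part:
  assumes f[measurable]: "f \<in> borel_measurable M" and pos: "integrable M (\<lambda>x. max (f x) 0)"
  shows "ereal_integral M f \<noteq> \<infinity>"
    and "\<not> integrable M f \<Longrightarrow> ereal_integral M f = - \<infinity>"
proof -
  have parts: "ennreal (pos_part f x) = ennreal (f x)" "ennreal (neg_part f x) = ennreal (- f x)" for x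
    by (auto simp: pos_part_def neg_part_def max_def min_def ennreal_neg)
  have "(\<integral>\<^sup>+x. ennreal (f x) \<partial>M) = (\<integral>\<^sup>+x. ennreal (max (f x) 0) \<partial>M)"
    by (intro nn_integral_cong) (auto simp: max_def ennreal_neg)
  also have "\<dots> = ennreal (LINT x|M. max (f x) 0)"
    using pos by (intro nn_integral_eq_integral) auto
  finally have eq: "(\<integral>\<^sup>+x. ennreal (f x) \<partial>M) = ennreal (LINT x|M. max (f x) 0)" .
  have nn: "(LINT x|M. max (f x) 0) \<ge> 0" by simp
  show "ereal_integral M f \<noteq> \<infinity>"
    by (simp add: ereal_integral_def parts eq nn enn2ereal_nonneg ereal_minus_eq_PInfty_iff)
  assume "\<not> integrable M f"
  then have "(\<integral>\<^sup>+x. ennreal (- f x) \<partial>M) = \<infinity>"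
    using eq f by (auto simp: real_integrable_def)
  then show "ereal_integral M f = - \<infinity>"
    by (simp add: ereal_integral_def parts eq nn)
qed

section \<open>Marginals with density bounded below\<close>

lemma Lspace_one_iff: "f \<in> Lspace 1 M \<longleftrightarrow> integrable M f"
  by (auto simp: Lspace_def integrable_abs_iff)

locale regular_marginal = lam: finite_measure lam + mu: prob_space mu
  for lam mu :: "'a measure" +
  fixes p q \<delta> :: real
  assumes p: "p \<ge> 2" and pq: "1 / p + 1 / q = 1"
    and sets_mu: "sets mu = sets lam" and ac: "absolutely_continuous lam mu"
    and density_Lp: "real_RN_deriv lam mu \<in> Lspace p lam"
    and \<delta>: "\<delta> > 0" and density_ge: "AE x in lam. real_RN_deriv lam mu x \<ge> \<delta>"
begin

abbreviation rho :: "'a \<Rightarrow> real" where "rho \<equiv> real_RN_deriv lam mu"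

lemma q: "1 < q" "q \<le> 2"
proof -
  have "1 / p \<le> 1 / 2" "1 / p > 0" using p by (auto simp: field_simps)
  then have "1 / q \<ge> 1 / 2" "1 / q < 1" using pq by linarith+
  moreover from this have "q > 0" by (smt (verit) zero_less_divide_1_iff)
  ultimately show "1 < q" "q \<le> 2" by (auto simp: field_simps)
qed

lemma space_mu: "space mu = space lam"
  using sets_mu by (rule sets_eq_imp_space_eq)

lemma measurable_rho[measurable]: "rho \<in> borel_measurable lam"
  using density_Lp by (simp add: Lspace_def)

lemma rho_nonneg: "rho x \<ge> 0"
  by (simp add: real_RN_deriv_def)

lemma integrable_mu_iff:
  "f \<in> borel_measurable lam \<Longrightarrow> integrable mu f \<longleftrightarrow> integrable lam (\<lambda>x. rho x * f x)"
  unfolding real_RN_deriv_def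
  by (rule lam.RN_deriv_integrable) (simp_all add: mu.sigma_finite_measure_axioms ac sets_mu)

lemma integral_mu:
  "f \<in> borel_measurable lam \<Longrightarrow> integral\<^sup>L mu f = (LINT x|lam. rho x * f x)"
  unfolding real_RN_deriv_def
  by (rule lam.RN_deriv_integral) (simp_all add: mu.sigma_finite_measure_axioms ac sets_mu)

lemma integrable_mu_bounded:
  fixes f :: "'a \<Rightarrow> real"
  assumes f: "f \<in> borel_measurable lam" and "\<And>x. x \<in> space lam \<Longrightarrow> \<bar>f x\<bar> \<le> B"
  shows "integrable mu f"
  using assms measurable_cong_sets[OF sets_mu refl, of borel]
  by (intro mu.integrable_const_bound[of _ B]) (auto simp: space_mu)

lemma integrable_rho: "integrable lam rho"
  using integrable_mu_iff[of "\<lambda>_. 1"] by simp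

text \<open>Since \<open>mu\<close> is a probability measure dominated by \<open>lam\<close>, the measure \<open>lam\<close> is not zero.\<close>
lemma ex_point_of_AE:
  assumes "AE x in lam. P x"
  obtains x where "x \<in> space lam" "P x"
proof -
  have "AE x in mu. P x \<and> x \<in> space lam"
    using absolutely_continuous_AE[OF sets_mu ac assms] AE_space[of mu] by (auto simp: space_mu)
  then have "\<exists>x. P x \<and> x \<in> space lam"
    by (rule eventually_happens'[OF mu.ae_filter_bot])
  with that show ?thesis by blast
qed

text \<open>Hoelder's inequality between \<open>f\<close> and the density, in the form of Young's pointwise bound.\<close>
lemma integrable_mu_of_Lq:
  assumes [measurable]: "f \<in> borel_measurable lam" and f: "\<And>x. 0 \<le> f x"
    and Lq: "integrable lam (\<lambda>x. f x powr q)"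
  shows "integrable mu f"
  unfolding integrable_mu_iff[OF assms(1)]
proof (rule Bochner_Integration.integrable_bound)
  show "integrable lam (\<lambda>x. rho x powr p / p + f x powr q / q)"
    using Lq density_Lp by (auto simp: Lspace_def rho_nonneg)
  show "AE x in lam. norm (rho x * f x) \<le> norm (rho x powr p / p + f x powr q / q)"
    using Youngs_inequality[of p q "rho x" "f x" for x] p q pq f rho_nonneg
    by (intro AE_I2) (simp add: abs_mult)
qed simp

lemma Lq_of_parts:
  assumes [measurable]: "f \<in> borel_measurable lam"
    and pos: "integrable lam (\<lambda>x. max (f x) 0 powr q)" and neg: "AE x in lam. - f x \<le> B"
  shows "f \<in> Lspace q lam"
  unfolding Lspace_def
proof safe
  show "integrable lam (\<lambda>x. \<bar>f x\<bar> powr q)"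
  proof (rule Bochner_Integration.integrable_bound)
    show "integrable lam (\<lambda>x. max (f x) 0 powr q + \<bar>B\<bar> powr q)"
      using pos by simp
    show "AE x in lam. norm (\<bar>f x\<bar> powr q) \<le> norm (max (f x) 0 powr q + \<bar>B\<bar> powr q)"
      using neg
    proof eventually_elim
      case (elim x)
      have "\<bar>f x\<bar> powr q \<le> max (f x) 0 powr q + \<bar>B\<bar> powr q"
      proof (cases "f x \<ge> 0")
        case False
        then have "\<bar>f x\<bar> powr q \<le> \<bar>B\<bar> powr q" using elim q by (intro powr_mono2) auto
        then show ?thesis by (smt (verit) powr_ge_zero)
      qed simp
      then show ?case by simp
    qed
  qed simp
qed simp

end

section \<open>First-order optimality\<close>

text \<open>The minimisation problem on abstract measure spaces. Compactness and continuity enter only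
  through the boundedness and measurability of the cost \<open>c\<close>.\<close>
locale dual_problem =
  m1: regular_marginal lam1 mu1 p q \<delta> + m2: regular_marginal lam2 mu2 p q \<delta>
  for lam1 mu1 :: "'a measure" and lam2 mu2 :: "'b measure" and p q \<delta> :: real +
  fixes \<gamma> C :: real and c :: "'a \<times> 'b \<Rightarrow> real"
  assumes \<gamma>: "\<gamma> > 0"
    and measurable_c[measurable]: "c \<in> borel_measurable (lam1 \<Otimes>\<^sub>M lam2)"
    and c_bound: "\<And>z. z \<in> space (lam1 \<Otimes>\<^sub>M lam2) \<Longrightarrow> \<bar>c z\<bar> \<le> C"
begin

sublocale pair_sigma_finite lam1 lam2 ..

sublocale prod: finite_measure "lam1 \<Otimes>\<^sub>M lam2"
  by (intro finite_measure_pair_measure m1.lam.finite_measure_axioms m2.lam.finite_measure_axioms)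

lemmas q = m1.q

abbreviation g :: real where "g \<equiv> \<gamma> powr (q - 1)"

definition slack :: "('a \<Rightarrow> real) \<Rightarrow> ('b \<Rightarrow> real) \<Rightarrow> 'a \<times> 'b \<Rightarrow> real"
  where "slack a1 a2 z = a1 (fst z) + a2 (snd z) - c z"

lemma slack_eq_fsum: "(a1 \<oplus>\<^sub>f a2) z - c z = slack a1 a2 z"
  by (simp add: slack_def fsum_def split_beta)

lemma pos_part_slack: "pos_part (\<lambda>z. (a1 \<oplus>\<^sub>f a2) z - c z) z = max (slack a1 a2 z) 0"
  by (simp add: pos_part_def slack_eq_fsum)

lemma measurable_slack[measurable]:
  assumes [measurable]: "a1 \<in> borel_measurable lam1" "a2 \<in> borel_measurable lam2"
  shows "slack a1 a2 \<in> borel_measurable (lam1 \<Otimes>\<^sub>M lam2)"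
  unfolding slack_def[abs_def] by measurable

lemma feasible_iff:
  "P_feasible q \<gamma> lam1 lam2 c (a1, a2) \<longleftrightarrow> integrable lam1 a1 \<and> integrable lam2 a2 \<and>
    integrable (lam1 \<Otimes>\<^sub>M lam2) (\<lambda>z. max (slack a1 a2 z) 0 powr q)"
proof -
  have eq: "\<bar>1 / \<gamma> * max u 0\<bar> powr q = inverse (\<gamma> powr q) * max u 0 powr q" for u :: real
  proof -
    have "\<bar>1 / \<gamma> * max u 0\<bar> powr q = (max u 0 / \<gamma>) powr q" using \<gamma> by simp
    also have "\<dots> = max u 0 powr q / \<gamma> powr q" by (rule powr_divide)
    finally show ?thesis by (simp add: divide_inverse mult.commute)
  qed
  have "(\<lambda>z. 1 / \<gamma> * max (slack a1 a2 z) 0) \<in> Lspace q (lam1 \<Otimes>\<^sub>M lam2) \<longleftrightarrow>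
      integrable (lam1 \<Otimes>\<^sub>M lam2) (\<lambda>z. max (slack a1 a2 z) 0 powr q)"
    if [measurable]: "a1 \<in> borel_measurable lam1" "a2 \<in> borel_measurable lam2"
    unfolding Lspace_def mem_Collect_eq eq using \<gamma> by (simp add: integrable_mult_left_iff)
  then show ?thesis
    unfolding P_feasible_def Lspace_one_iff pos_part_slack
    by (auto dest: borel_measurable_integrable)
qed

text \<open>By Fubini some section \<open>x \<mapsto> (a1 x + a2 y - c (x, y))\<^sub>+ powr q\<close> with a fixed \<open>y\<close> is integrable.
  On it \<open>a2 y - c (x, y)\<close> is bounded in \<open>x\<close> and can be shifted away; likewise with the roles of
  the factors exchanged.\<close>
lemma feasible_pos_parts:
  assumes "P_feasible q \<gamma> lam1 lam2 c (a1, a2)"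
  shows "integrable lam1 (\<lambda>x. max (a1 x) 0 powr q)" "integrable lam2 (\<lambda>y. max (a2 y) 0 powr q)"
proof -
  have [measurable]: "a1 \<in> borel_measurable lam1" "a2 \<in> borel_measurable lam2"
    and int: "integrable (lam1 \<Otimes>\<^sub>M lam2) (\<lambda>(x, y). max (slack a1 a2 (x, y)) 0 powr q)"
    using assms by (auto simp: feasible_iff case_prod_unfold)
  obtain y where y[simp]: "y \<in> space lam2"
    and int_y: "integrable lam1 (\<lambda>x. max (slack a1 a2 (x, y)) 0 powr q)"
    using m2.ex_point_of_AE[OF AE_integrable_snd[OF int]] by blast
  have "integrable lam1 (\<lambda>x. max (slack a1 a2 (x, y) + (c (x, y) - a2 y)) 0 powr q)"
  proof (rule integrable_pos_powr_bounded_shift(3)[OF m1.lam.finite_measure_axioms q _ _ _ int_y])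
    show "\<bar>c (x, y) - a2 y\<bar> \<le> C + \<bar>a2 y\<bar>" if "x \<in> space lam1" for x
      using c_bound[of "(x, y)"] that by (simp add: space_pair_measure)
  qed measurable
  then show "integrable lam1 (\<lambda>x. max (a1 x) 0 powr q)"
    by (simp add: slack_def)
  obtain x where x[simp]: "x \<in> space lam1"
    and int_x: "integrable lam2 (\<lambda>y. max (slack a1 a2 (x, y)) 0 powr q)"
    using m1.ex_point_of_AE[OF AE_integrable_fst[OF int]] by blast
  have "integrable lam2 (\<lambda>y. max (slack a1 a2 (x, y) + (c (x, y) - a1 x)) 0 powr q)"
  proof (rule integrable_pos_powr_bounded_shift(3)[OF m2.lam.finite_measure_axioms q _ _ _ int_x])
    show "\<bar>c (x, y) - a1 x\<bar> \<le> C + \<bar>a1 x\<bar>" if "y \<in> space lam2" for y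
      using c_bound[of "(x, y)"] that by (simp add: space_pair_measure)
  qed measurable
  then show "integrable lam2 (\<lambda>y. max (a2 y) 0 powr q)"
    by (simp add: slack_def)
qed

abbreviation objective :: "('a \<Rightarrow> real) \<times> ('b \<Rightarrow> real) \<Rightarrow> ereal"
  where "objective \<equiv> P_objective q \<gamma> lam1 lam2 c mu1 mu2"

lemma objective_eq:
  "objective (a1, a2) = ereal (1 / q * (LINT z|(lam1 \<Otimes>\<^sub>M lam2). max (slack a1 a2 z) 0 powr q))
    - ereal g * ereal_integral mu1 a1 - ereal g * ereal_integral mu2 a2"
  using q by (simp add: P_objective_def Lnorm_def pos_part_slack powr_powr)

definition real_objective :: "('a \<Rightarrow> real) \<Rightarrow> ('b \<Rightarrow> real) \<Rightarrow> real"
  where "real_objective a1 a2 = 1 / q * (LINT z|(lam1 \<Otimes>\<^sub>M lam2). max (slack a1 a2 z) 0 powr q)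
    - g * (LINT x|mu1. a1 x) - g * (LINT y|mu2. a2 y)"

lemma objective_eq_real:
  "integrable mu1 a1 \<Longrightarrow> integrable mu2 a2 \<Longrightarrow> objective (a1, a2) = ereal (real_objective a1 a2)"
  by (simp add: objective_eq real_objective_def ereal_integral_eq_integral)

text \<open>The positive parts have finite integrals, so a divergent integral of \<open>a1\<close> or \<open>a2\<close> can only be
  \<open>- \<infinity>\<close>, and it enters the objective with a negative factor.\<close>
lemma integrable_mu_if_objective_finite:
  assumes feas: "P_feasible q \<gamma> lam1 lam2 c (a1, a2)" and fin: "objective (a1, a2) \<noteq> \<infinity>"
  shows "integrable mu1 a1" "integrable mu2 a2"
proof -
  have meas[measurable]: "a1 \<in> borel_measurable lam1" "a2 \<in> borel_measurable lam2"
    using feas by (auto simp: feasible_iff)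
  have meas': "a1 \<in> borel_measurable mu1" "a2 \<in> borel_measurable mu2"
    using meas measurable_cong_sets[OF m1.sets_mu refl, of borel]
      measurable_cong_sets[OF m2.sets_mu refl, of borel] by auto
  have pos: "integrable mu1 (\<lambda>x. max (a1 x) 0)" "integrable mu2 (\<lambda>y. max (a2 y) 0)"
    using feasible_pos_parts[OF feas]
    by (auto intro!: m1.integrable_mu_of_Lq m2.integrable_mu_of_Lq)
  note I1 = ereal_integral_of_integrable_pos_part[OF meas'(1) pos(1)]
    and I2 = ereal_integral_of_integrable_pos_part[OF meas'(2) pos(2)]
  have g: "g > 0" using \<gamma> by simp
  have infinite: "ereal r - ereal g * i1 - ereal g * i2 = \<infinity>"
    if "i1 \<noteq> \<infinity>" "i2 \<noteq> \<infinity>" "i1 = - \<infinity> \<or> i2 = - \<infinity>" for r i1 i2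
    using that g by (cases i1; cases i2) auto
  show "integrable mu1 a1" "integrable mu2 a2"
    using fin infinite[OF I1(1) I2(1)] I1(2) I2(2) unfolding objective_eq by blast+
qed

text \<open>The constant pair \<open>(- C, - C)\<close> is a competitor of finite value: its slack is nonpositive because
  \<open>\<bar>c\<bar> \<le> C\<close>.\<close>
lemma optimal_objective_finite:
  assumes "P_optimal q \<gamma> lam1 lam2 c mu1 mu2 (a1, a2)"
  shows "objective (a1, a2) \<noteq> \<infinity>"
proof
  assume inf: "objective (a1, a2) = \<infinity>"
  define b1 :: "'a \<Rightarrow> real" where "b1 = (\<lambda>_. - C)"
  define b2 :: "'b \<Rightarrow> real" where "b2 = (\<lambda>_. - C)"
  obtain x y where "x \<in> space lam1" "y \<in> space lam2"
    using m1.mu.not_empty m2.mu.not_empty by (auto simp: m1.space_mu m2.space_mu)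
  then have "C \<ge> 0" using c_bound[of "(x, y)"] by (auto simp: space_pair_measure)
  then have "max (slack b1 b2 z) 0 = 0" if "z \<in> space (lam1 \<Otimes>\<^sub>M lam2)" for z
    using c_bound[OF that] by (simp add: slack_def b1_def b2_def)
  then have "integrable (lam1 \<Otimes>\<^sub>M lam2) (\<lambda>z. max (slack b1 b2 z) 0 powr q)"
    by (subst Bochner_Integration.integrable_cong[OF refl, of _ _ "\<lambda>_. 0"]) auto
  then have "P_feasible q \<gamma> lam1 lam2 c (b1, b2)"
    by (simp add: feasible_iff b1_def b2_def)
  moreover have "objective (b1, b2) < objective (a1, a2)"
    unfolding inf by (subst objective_eq_real) (simp_all add: b1_def b2_def)
  ultimately show False
    using assms by (auto simp: P_optimal_def is_arg_min_def)
qed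

text \<open>The Euler-Lagrange equation in weak form. Let \<open>D\<close> be the integral on the left and \<open>g * I\<close> the right-hand
  side. Moving along \<open>t * (\<phi>1, \<phi>2)\<close> stays feasible, and by the expansion of \<open>max x 0 powr q\<close> the
  objective increases by at most \<open>(D - g * I) * t + R * \<bar>t\<bar> powr q\<close> for a constant \<open>R\<close>. Optimality
  makes this nonnegative for every \<open>t\<close>, hence \<open>D = g * I\<close>.\<close>
lemma stationarity:
  assumes opt: "P_optimal q \<gamma> lam1 lam2 c mu1 mu2 (a1, a2)"
    and [measurable]: "\<phi>1 \<in> borel_measurable lam1" "\<phi>2 \<in> borel_measurable lam2"
    and bound1: "\<And>x. x \<in> space lam1 \<Longrightarrow> \<bar>\<phi>1 x\<bar> \<le> B1" and bound2: "\<And>y. y \<in> space lam2 \<Longrightarrow> \<bar>\<phi>2 y\<bar> \<le> B2"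
  shows "(LINT z|(lam1 \<Otimes>\<^sub>M lam2). max (slack a1 a2 z) 0 powr (q - 1) * (\<phi>1 (fst z) + \<phi>2 (snd z)))
    = g * ((LINT x|mu1. \<phi>1 x) + (LINT y|mu2. \<phi>2 y))"
proof -
  let ?L = "lam1 \<Otimes>\<^sub>M lam2"
  have feas: "P_feasible q \<gamma> lam1 lam2 c (a1, a2)"
    and min: "\<And>b1 b2. P_feasible q \<gamma> lam1 lam2 c (b1, b2) \<Longrightarrow> \<not> objective (b1, b2) < objective (a1, a2)"
    using opt by (auto simp: P_optimal_def is_arg_min_def)
  have int: "integrable lam1 a1" "integrable lam2 a2" "integrable ?L (\<lambda>z. max (slack a1 a2 z) 0 powr q)"
    using feas by (auto simp: feasible_iff)
  then have [measurable]: "a1 \<in> borel_measurable lam1" "a2 \<in> borel_measurable lam2" by auto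
  have int_mu: "integrable mu1 a1" "integrable mu2 a2"
    using integrable_mu_if_objective_finite[OF feas optimal_objective_finite[OF opt]] by auto
  have int_phi: "integrable lam1 \<phi>1" "integrable lam2 \<phi>2" "integrable mu1 \<phi>1" "integrable mu2 \<phi>2"
    using bound1 bound2
    by (auto intro!: m1.lam.integrable_const_bound[of _ B1] m2.lam.integrable_const_bound[of _ B2]
        m1.integrable_mu_bounded[of _ B1] m2.integrable_mu_bounded[of _ B2])
  define \<psi> where "\<psi> z = \<phi>1 (fst z) + \<phi>2 (snd z)" for z
  have [measurable]: "\<psi> \<in> borel_measurable ?L" unfolding \<psi>_def[abs_def] by measurable
  have bound: "\<bar>t * \<psi> z\<bar> \<le> \<bar>t\<bar> * (B1 + B2)" if "z \<in> space ?L" for t z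
  proof -
    have "\<bar>\<psi> z\<bar> \<le> B1 + B2"
      using bound1[of "fst z"] bound2[of "snd z"] that by (auto simp: \<psi>_def space_pair_measure)
    then show ?thesis by (simp add: abs_mult mult_left_mono)
  qed
  define D where "D = (LINT z|?L. max (slack a1 a2 z) 0 powr (q - 1) * \<psi> z)"
  define R where "R = (LINT z|?L. \<bar>\<psi> z\<bar> powr q)"
  define I where "I = (LINT x|mu1. \<phi>1 x) + (LINT y|mu2. \<phi>2 y)"
  have "0 \<le> (D - g * I) * t + R * \<bar>t\<bar> powr q" for t
  proof -
    define b1 where "b1 x = a1 x + t * \<phi>1 x" for x
    define b2 where "b2 y = a2 y + t * \<phi>2 y" for y
    have slack_b: "slack b1 b2 z = slack a1 a2 z + t * \<psi> z" for z
      by (simp add: slack_def b1_def b2_def \<psi>_def algebra_simps)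
    note shift = integrable_pos_powr_bounded_shift[OF prod.finite_measure_axioms q _ _ bound int(3), of t]
    have i1: "integrable ?L (\<lambda>z. max (slack a1 a2 z) 0 powr (q - 1) * (t * \<psi> z))"
      and i2: "integrable ?L (\<lambda>z. \<bar>t * \<psi> z\<bar> powr q)"
      and i3: "integrable ?L (\<lambda>z. max (slack b1 b2 z) 0 powr q)"
      unfolding slack_b by (rule shift; measurable)+
    have "P_feasible q \<gamma> lam1 lam2 c (b1, b2)"
      using int int_phi i3 by (simp add: feasible_iff b1_def[abs_def] b2_def[abs_def])
    with min have "\<not> objective (b1, b2) < objective (a1, a2)" by blast
    then have "real_objective a1 a2 \<le> real_objective b1 b2"
      using int_mu int_phi by (simp add: objective_eq_real b1_def[abs_def] b2_def[abs_def] not_less)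
    then have "1 / q * (LINT z|?L. max (slack a1 a2 z) 0 powr q) + g * (t * I)
        \<le> 1 / q * (LINT z|?L. max (slack b1 b2 z) 0 powr q)"
      using int_mu int_phi
      by (simp add: real_objective_def b1_def[abs_def] b2_def[abs_def] I_def algebra_simps)
    from mult_left_mono[OF this, of q]
    have 1: "(LINT z|?L. max (slack a1 a2 z) 0 powr q) + q * (g * (t * I))
        \<le> (LINT z|?L. max (slack b1 b2 z) 0 powr q)"
      using q by (simp add: distrib_left)
    have "(LINT z|?L. max (slack b1 b2 z) 0 powr q)
      \<le> (LINT z|?L. max (slack a1 a2 z) 0 powr q
            + q * (max (slack a1 a2 z) 0 powr (q - 1) * (t * \<psi> z)) + q * \<bar>t * \<psi> z\<bar> powr q)"
      using i1 i2 i3 int(3)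
      by (intro integral_mono) (auto simp: slack_b intro!: pos_powr_add_le_expansion q)
    also have "\<dots> = (LINT z|?L. max (slack a1 a2 z) 0 powr q)
        + q * (LINT z|?L. max (slack a1 a2 z) 0 powr (q - 1) * (t * \<psi> z)) + q * (LINT z|?L. \<bar>t * \<psi> z\<bar> powr q)"
      using i1 i2 int(3) by simp
    also have "(LINT z|?L. max (slack a1 a2 z) 0 powr (q - 1) * (t * \<psi> z)) = t * D"
      unfolding D_def by (subst integral_mult_right_zero[symmetric]) (simp add: ac_simps)
    also have "(LINT z|?L. \<bar>t * \<psi> z\<bar> powr q) = \<bar>t\<bar> powr q * R"
      unfolding R_def by (subst integral_mult_right_zero[symmetric]) (simp add: abs_mult powr_mult)
    finally have "q * (g * (t * I)) \<le> q * (t * D + \<bar>t\<bar> powr q * R)"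
      using 1 by (simp add: algebra_simps)
    then have "g * (t * I) \<le> t * D + \<bar>t\<bar> powr q * R"
      using q by simp
    then show ?thesis by (simp add: algebra_simps)
  qed
  from linear_coefficient_eq_zero[OF q(1) this] show ?thesis
    by (simp add: D_def \<psi>_def I_def)
qed

text \<open>Testing the Euler-Lagrange equation with the indicator of a set in one variable and 0 in the other
  shows that both sides have the same integral over every measurable set.\<close>
lemma marginal_equations:
  assumes opt: "P_optimal q \<gamma> lam1 lam2 c mu1 mu2 (a1, a2)"
  shows "AE x in lam1. (LINT y|lam2. max (slack a1 a2 (x, y)) 0 powr (q - 1)) = g * m1.rho x"
    and "AE y in lam2. (LINT x|lam1. max (slack a1 a2 (x, y)) 0 powr (q - 1)) = g * m2.rho y"
proof -
  let ?L = "lam1 \<Otimes>\<^sub>M lam2"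
  let ?w = "\<lambda>z. max (slack a1 a2 z) 0 powr (q - 1)"
  have feas: "P_feasible q \<gamma> lam1 lam2 c (a1, a2)"
    using opt by (auto simp: P_optimal_def is_arg_min_def)
  then have [measurable]: "a1 \<in> borel_measurable lam1" "a2 \<in> borel_measurable lam2"
    by (auto simp: feasible_iff)
  have w: "integrable ?L ?w"
    using feas q by (intro integrable_pos_powr_minus_one prod.finite_measure_axioms) (auto simp: feasible_iff)
  then have w': "integrable ?L (\<lambda>(x, y). ?w (x, y))" by (simp add: case_prod_unfold)
  show "AE x in lam1. (LINT y|lam2. ?w (x, y)) = g * m1.rho x"
  proof (rule density_unique_real)
    fix A assume A[measurable]: "A \<in> sets lam1"
    have wA: "integrable ?L (\<lambda>(x, y). ?w (x, y) * indicator A x)"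
      by (rule Bochner_Integration.integrable_bound[OF w]) (auto simp: case_prod_unfold indicator_def)
    have "(LINT x:A|lam1. (LINT y|lam2. ?w (x, y))) = (LINT x|lam1. (LINT y|lam2. ?w (x, y) * indicator A x))"
      by (simp add: set_lebesgue_integral_def mult.commute)
    also have "\<dots> = (LINT z|?L. ?w z * indicator A (fst z))"
      using integral_fst[OF wA] by (simp add: case_prod_unfold)
    also have "\<dots> = g * (LINT x|mu1. indicator A x)"
      using stationarity[OF opt, of "indicator A" "\<lambda>_. 0" 1 0] by (simp add: indicator_def)
    also have "\<dots> = (LINT x:A|lam1. g * m1.rho x)"
      by (subst m1.integral_mu) (auto simp: set_lebesgue_integral_def ac_simps)
    finally show "(LINT x:A|lam1. (LINT y|lam2. ?w (x, y))) = (LINT x:A|lam1. g * m1.rho x)" .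
  qed (use integrable_fst[OF w'] m1.integrable_rho in auto)
  show "AE y in lam2. (LINT x|lam1. ?w (x, y)) = g * m2.rho y"
  proof (rule density_unique_real)
    fix A assume A[measurable]: "A \<in> sets lam2"
    have wA: "integrable ?L (\<lambda>(x, y). ?w (x, y) * indicator A y)"
      by (rule Bochner_Integration.integrable_bound[OF w]) (auto simp: case_prod_unfold indicator_def)
    have "(LINT y:A|lam2. (LINT x|lam1. ?w (x, y))) = (LINT y|lam2. (LINT x|lam1. ?w (x, y) * indicator A y))"
      by (simp add: set_lebesgue_integral_def mult.commute)
    also have "\<dots> = (LINT z|?L. ?w z * indicator A (snd z))"
      using integral_snd[OF wA] by (simp add: case_prod_unfold)
    also have "\<dots> = g * (LINT y|mu2. indicator A y)"
      using stationarity[OF opt, of "\<lambda>_. 0" "indicator A" 0 1] by (simp add: indicator_def)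
    also have "\<dots> = (LINT y:A|lam2. g * m2.rho y)"
      by (subst m2.integral_mu) (auto simp: set_lebesgue_integral_def ac_simps)
    finally show "(LINT y:A|lam2. (LINT x|lam1. ?w (x, y))) = (LINT y:A|lam2. g * m2.rho y)" .
  qed (use integrable_snd[OF w'] m2.integrable_rho in auto)
qed

text \<open>For almost every \<open>x\<close> the marginal equation gives \<open>\<integral> (a1 x + a2 y - c (x, y))\<^sub>+ powr (q - 1)\<close>
  at least the value \<open>g * \<delta> > 0\<close>, which would be impossible if \<open>a1 x\<close> were very negative, as
  \<open>(a2)\<^sub>+\<close> has a finite \<open>q\<close>-th moment.\<close>
lemma neg_parts_bounded:
  assumes opt: "P_optimal q \<gamma> lam1 lam2 c mu1 mu2 (a1, a2)"
  shows "\<exists>B. AE x in lam1. - a1 x \<le> B" "\<exists>B. AE y in lam2. - a2 y \<le> B"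
proof -
  have feas: "P_feasible q \<gamma> lam1 lam2 c (a1, a2)"
    using opt by (auto simp: P_optimal_def is_arg_min_def)
  have g: "g * \<delta> > 0" using \<gamma> m1.\<delta> by simp
  have slack_le: "slack a1 a2 (x, y) \<le> a1 x + a2 y + C" if "x \<in> space lam1" "y \<in> space lam2" for x y
    using c_bound[of "(x, y)"] that by (auto simp: slack_def space_pair_measure)
  have "AE x in lam1. - a1 x \<le> C + ((LINT y|lam2. max (a2 y) 0 powr q) + 1) / (g * \<delta>)"
    using marginal_equations(1)[OF opt] m1.density_ge AE_space
  proof eventually_elim
    case (elim x)
    show ?case
    proof (rule lower_bound_from_truncated_mass[OF q(1) feasible_pos_parts(2)[OF feas] g])
      show "g * \<delta> \<le> (LINT y|lam2. max (slack a1 a2 (x, y)) 0 powr (q - 1))"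
        using elim by (simp add: mult_left_mono)
    qed (use slack_le elim in auto)
  qed
  then show "\<exists>B. AE x in lam1. - a1 x \<le> B" by blast
  have "AE y in lam2. - a2 y \<le> C + ((LINT x|lam1. max (a1 x) 0 powr q) + 1) / (g * \<delta>)"
    using marginal_equations(2)[OF opt] m2.density_ge AE_space
  proof eventually_elim
    case (elim y)
    show ?case
    proof (rule lower_bound_from_truncated_mass[OF q(1) feasible_pos_parts(1)[OF feas] g])
      show "g * \<delta> \<le> (LINT x|lam1. max (slack a1 a2 (x, y)) 0 powr (q - 1))"
        using elim by (simp add: mult_left_mono)
      show "slack a1 a2 (x, y) \<le> a2 y + a1 x + C" if "x \<in> space lam1" for x
        using slack_le[OF that, of y] elim by simp
    qed
  qed
  then show "\<exists>B. AE y in lam2. - a2 y \<le> B" by blast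
qed

end

section \<open>Regularity of the optimal pair\<close>

theorem theorem3p13:
  fixes \<Omega>1 \<Omega>2 :: "(real ^ 'n) set"
    and lam1 lam2 \<mu>1 \<mu>2 :: "(real ^ 'n) measure"
    and p q \<gamma> \<delta> cdag :: real
    and c :: "(real ^ 'n) \<times> (real ^ 'n) \<Rightarrow> real"
    and a1 a2 :: "real ^ 'n \<Rightarrow> real"
  assumes "compact \<Omega>1" and "compact \<Omega>2"
    and "finite_radon_measure_on \<Omega>1 lam1" and "finite_radon_measure_on \<Omega>2 lam2"
    and "spt lam1 = \<Omega>1" and "spt lam2 = \<Omega>2"
    and "p \<ge> 2" and "1 / p + 1 / q = 1" and "\<gamma> > 0"
    and "continuous_on (\<Omega>1 \<times> \<Omega>2) c" and "\<forall>z \<in> \<Omega>1 \<times> \<Omega>2. c z \<ge> cdag"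
    and "prob_space \<mu>1" and "prob_space \<mu>2"
    and "sets \<mu>1 = sets lam1" and "sets \<mu>2 = sets lam2"
    and "absolutely_continuous lam1 \<mu>1" and "absolutely_continuous lam2 \<mu>2"
    and "real_RN_deriv lam1 \<mu>1 \<in> Lspace p lam1" and "real_RN_deriv lam2 \<mu>2 \<in> Lspace p lam2"
    and "\<delta> > 0"
    and "AE x in lam1. real_RN_deriv lam1 \<mu>1 x \<ge> \<delta>" and "AE x in lam2. real_RN_deriv lam2 \<mu>2 x \<ge> \<delta>"
    and "P_optimal q \<gamma> lam1 lam2 c \<mu>1 \<mu>2 (a1, a2)"
  shows "a1 \<in> Lspace q lam1 \<and> a2 \<in> Lspace q lam2 \<and>
    (\<exists>B. AE x in lam1. neg_part a1 x \<le> B) \<and> (\<exists>B. AE x in lam2. neg_part a2 x \<le> B) \<and>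
    (AE x1 in lam1.
      (LINT x2|lam2. 1 / \<gamma> powr (q - 1) *
         pos_part (\<lambda>z. (a1 \<oplus>\<^sub>f a2) z - c z) (x1, x2) powr (q - 1)) = real_RN_deriv lam1 \<mu>1 x1) \<and>
    (AE x2 in lam2.
      (LINT x1|lam1. 1 / \<gamma> powr (q - 1) *
         pos_part (\<lambda>z. (a1 \<oplus>\<^sub>f a2) z - c z) (x1, x2) powr (q - 1)) = real_RN_deriv lam2 \<mu>2 x2)"
proof -
  note A = assms
  have sets: "sets lam1 = sets (restrict_space borel \<Omega>1)" "sets lam2 = sets (restrict_space borel \<Omega>2)"
    and fin: "finite_measure lam1" "finite_measure lam2"
    using A(3,4) by (auto simp: finite_radon_measure_on_def)
  have space: "space (lam1 \<Otimes>\<^sub>M lam2) = \<Omega>1 \<times> \<Omega>2"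
    using sets[THEN sets_eq_imp_space_eq] by (simp add: space_pair_measure space_restrict_space)
  have id_measurable: "(\<lambda>x. x) \<in> borel_measurable lam1" "(\<lambda>x. x) \<in> borel_measurable lam2"
    by (simp_all add: measurable_cong_sets[OF sets(1) refl] measurable_cong_sets[OF sets(2) refl]
        measurable_restrict_space1)
  \<comment> \<open>On second countable spaces the Borel algebra of a product is the product of the Borel algebras, so the inclusion of \<open>\<Omega>1 \<times> \<Omega>2\<close> is measurable for the product measure.\<close>
  then have "(\<lambda>z. (fst z, snd z)) \<in> borel_measurable (lam1 \<Otimes>\<^sub>M lam2)"
    by (intro borel_measurable_Pair measurable_compose[OF measurable_fst]
        measurable_compose[OF measurable_snd])
  then have "(\<lambda>z. z) \<in> lam1 \<Otimes>\<^sub>M lam2 \<rightarrow>\<^sub>M restrict_space borel (\<Omega>1 \<times> \<Omega>2)"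
    by (intro measurable_restrict_space2) (simp_all add: space)
  then have c_measurable: "c \<in> borel_measurable (lam1 \<Otimes>\<^sub>M lam2)"
    using borel_measurable_continuous_on_restrict[OF A(10)] by (rule measurable_compose)
  have "bounded (c ` (\<Omega>1 \<times> \<Omega>2))"
    using A(1,2,10) by (intro compact_imp_bounded compact_continuous_image compact_Times)
  then obtain C where C: "\<And>z. z \<in> \<Omega>1 \<times> \<Omega>2 \<Longrightarrow> \<bar>c z\<bar> \<le> C"
    by (auto simp: bounded_iff)
  interpret dual_problem lam1 \<mu>1 lam2 \<mu>2 p q \<delta> \<gamma> C c
  proof (intro dual_problem.intro regular_marginal.intro)
    show "dual_problem_axioms lam1 lam2 \<gamma> C c"
      by standard (use A(9) c_measurable C in \<open>auto simp: space\<close>)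
  qed (use A fin in \<open>auto intro!: regular_marginal_axioms.intro\<close>)
  have feas: "P_feasible q \<gamma> lam1 lam2 c (a1, a2)"
    using A(23) by (auto simp: P_optimal_def is_arg_min_def)
  then have meas: "a1 \<in> borel_measurable lam1" "a2 \<in> borel_measurable lam2"
    by (auto simp: feasible_iff)
  obtain B1 B2 where B: "AE x in lam1. - a1 x \<le> B1" "AE y in lam2. - a2 y \<le> B2"
    using neg_parts_bounded[OF A(23)] by blast
  have neg: "neg_part f x \<le> max B 0" if "- f x \<le> B" for f :: "real ^ 'n \<Rightarrow> real" and x B
    using that by (auto simp: neg_part_def)
  have g: "g \<noteq> 0" using A(9) by simp
  show ?thesis
  proof (intro conjI)
    show "a1 \<in> Lspace q lam1" "a2 \<in> Lspace q lam2"
      using m1.Lq_of_parts[OF meas(1) feasible_pos_parts(1)[OF feas] B(1)]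
        m2.Lq_of_parts[OF meas(2) feasible_pos_parts(2)[OF feas] B(2)] by auto
    show "\<exists>B. AE x in lam1. neg_part a1 x \<le> B" "\<exists>B. AE x in lam2. neg_part a2 x \<le> B"
      using B by (auto elim!: eventually_mono intro: neg)
  qed (use marginal_equations[OF A(23)] g in \<open>auto simp: pos_part_slack\<close>)
qed

end
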